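(* Let $a$ and $d$ be positive integers with $a\ge 2$ and $\gcd(a,d)=1$, let $K$ and $k$ be positive integers with $(k-1)/2<K\le (2k-2)/3$, and let $r=a+K-\lfloor (a+K)/k\rfloor k$. Assume that $\lfloor (a+K)/k\rfloor\ge 2$. Write $S=s\bigl(a,a+(K+1)d,a+(K+2)d,\dots,a+k d\bigr)$. If $0\le r\le k-K-1$, then \begin{align*} S&=\frac{1}{12 k^2}\biggl(2 a^4+6(3 K-k)a^3+\bigl(30 K^2-7 k^2+12 k-6(r+4 K-3 k)r\bigr)a^2\\ &\quad +\bigl(K^2(14 K+6 k)-4 K k(8 k-3)+12 k^2(k-1)+4 r^3+6(K-2 k)r^2-(24 K^2-6 K k-8 k^2+12 k)r\bigr)a -k^2\\ &\quad +\bigl(2 a^2+3(6 K-2 k+1)a+6 K(5 K+7)-(6 k^2+6 k-13)\bigr)k^2 d^2\\ &\quad +\bigl(4 a^3+3(12 K-4 k+1)a^2+\bigl(6 K(10 K+7 k)-(13 k^2-6 k-12)-6 r(r+4 K-3 k)\bigr)a\\ &\qquad +28 K^3-K^2(27 k-39)-K(7 k^2+45 k-12)+6(k-1)k(k+2)\bigr)k d\biggr). \end{align*} If $k-K\le r\le K$, then \begin{align*} S&=\frac{1}{12 k^2}\biggl(2 a^4+6(3 K-k)a^3+\bigl(30 K^2+12 K k-19 k^2+24 k-6(r+4 K-5 k)r\bigr)a^2\\ &\quad +\bigl(K^2(14 K+18 k)-8 K k(4 k-3)+4 r^3+6(K-4 k)r^2-(24 K^2-6 K k-32 k^2+24 k)r\bigr)a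 -k^2\\ &\quad +\bigl(2 a^2+3(6 K-2 k+1)a+6 K(5 K+7)-6 k^2-6 k+13\bigr)k^2 d^2\\ &\quad +\bigl(4 a^3+3(12 K-4 k+1)a^2+\bigl(6 K(10 K+2 k+7)-(25 k^2-18 k-12)-6 r(r+4 K-5 k)\bigr)a\\ &\qquad +28 K^3-K^2(9 k-39)-K(19 k^2+15 k-12)+2 r^3-3 r^2(2 K+3 k+1)\\ &\qquad +r\bigl(-K(24 K-18 k+36)+(19 k^2+15 k-12)\bigr)\bigr)k d\biggr). \end{align*} If $K+1\le r<k$, then \begin{align*} S&=\frac{1}{12 k^2}\biggl(2 a^4+6(3 K-k)a^3+\bigl(30 K^2+24 K k-19 k^2+12 k-6(r+4 K-3 k)r\bigr)a^2\\ &\quad +\bigl(K^2(14 K+30 k)-4 K k(5 k-3)+12 k^2(k-1)+4 r^3+6(K-2 k)r^2-(24 K^2+18 K k-20 k^2+12 k)r\bigr)a -k^2\\ &\quad +\bigl(2 a^2+3(6 K-2 k+1)a+6 K(5 K+7)-6 k^2-6 k+13\bigr)k^2 d^2\\ &\quad +\bigl(4 a^3+3(12 K-4 k+1)a^2+\bigl(6 K(10 K+4 k+7)-(25 k^2-6 k-12)-6 r(r+4 K-3 k)\bigr)a\\ &\qquad +28 K^3-3 K^2(k-13)-K(7 k^2+9 k-12)+2 r^3-3 r^2(2 K+k+1)\\ &\qquad +r\bigl(-6 K(4 K-k+6)+7 k^2+9 k-12\bigr)\bigr)k d\biggr). \end{align*}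
   Context: For positive integers $a_1,\dots,a_m$ with $\gcd(a_1,\dots,a_m)=1$, let $\mathrm{NR}(a_1,\dots,a_m)$ be the (finite) set of positive integers that cannot be written as $x_1a_1+\cdots+x_ma_m$ with nonnegative integers $x_i$. The Sylvester sum is $s(a_1,\dots,a_m)=\sum_{n\in\mathrm{NR}(a_1,\dots,a_m)} n$. $\lfloor x\rfloor$ denotes the floor.
   Formalization: Three misprints are corrected: for 0≤r≤k-K-1, 6K(10K+7k) becomes 6K(10K+7) and the kd-block gains 2r^3-3r^2(2K+k+1)+r(-6K(4K-k+6)+7k^2+9k-12); for K+1≤r<k, the summand 12k^2(k-1) is dropped from the coefficient of a. *)

theory Defs
  imports Complex_Main
begin

text \<open>
  The generators form a list \<open>as\<close> of positive integers with greatest common divisor 1.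
  The definitions are total: without the condition on the greatest common divisor the set may be
  infinite, and the sum then has the default value 0.
\<close>

text \<open>
  The closed forms stated for \<open>sylvester_sum\<close> differ from the printed source in three places, where
  the printed formulas are incorrect. In the case \<open>0 \<le> r \<le> k - K - 1\<close>, the factor \<open>10 K + 7\<close>
  is printed as \<open>10 K + 7 k\<close>, and the terms
  \<open>2 r^3 - 3 r^2 (2 K + k + 1) + r (- 6 K (4 K - k + 6) + 7 k^2 + 9 k - 12)\<close> in the coefficient of
  \<open>k d\<close> are missing. In the case \<open>K + 1 \<le> r < k\<close>, the coefficient of \<open>a\<close> is printed with a
  superfluous summand \<open>12 k^2 (k - 1)\<close>. For example, the printed value for
  \<open>a = 6, d = 1, K = 2, k = 4\<close> is 279/2, whereas the sum for the generators 6, 9, 10 is 108.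
\<close>

definition NR :: "int list \<Rightarrow> int set" where
  "NR as = {n. n > 0 \<and>
     \<not> (\<exists>x :: nat \<Rightarrow> int. (\<forall>i < length as. x i \<ge> 0) \<and> n = (\<Sum>i < length as. x i * as ! i))}"

definition sylvester_sum :: "int list \<Rightarrow> int" where
  "sylvester_sum as = (\<Sum>n \<in> NR as. n)"

end

theory Submission
  imports Defs
begin

text \<open>
  The sum of the gaps is determined by the first two moments of the Apery set of \<open>a\<close>. A sum of
  \<open>N\<close> generators other than \<open>a\<close> equals \<open>N a + J d\<close>, where \<open>J\<close> ranges over
  \<open>{N (K + 1)..N k}\<close>. By the bounds on \<open>K\<close> these intervals overlap or abut from \<open>N = 2\<close>
  on, so the only positive \<open>J\<close> that never occur lie in the two gaps \<open>{1..K}\<close> and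
  \<open>{k + 1..2 K + 1}\<close>. Hence the Apery element of the class of \<open>s d\<close> is
  \<open>\<lceil>J / k\<rceil> a + J d\<close> with \<open>J = s\<close>, or \<open>J = s + a\<close> if \<open>s\<close> lies in a gap. With
  \<open>a + K = q k + r\<close> the ceilings are constant on blocks of length \<open>k\<close>, and the three ranges of
  \<open>r\<close> record which of the shifted gaps contain a block boundary.
\<close>

section \<open>Finite sums over integer intervals\<close>

text \<open>Agreement with an affine function is asked on the interval only, so that sums involving
  \<open>parts\<close> can be evaluated block by block; \<open>\<beta> = 0\<close> covers constants.
  The factor 2 avoids division, and \<open>l = h + 1\<close> admits an empty block.\<close>

lemma sum_affine_int:
  fixes l h :: int and f :: "int \<Rightarrow> int"
  assumes "l \<le> h + 1" and f: "\<And>s. l \<le> s \<Longrightarrow> s \<le> h \<Longrightarrow> f s = \<alpha> + \<beta> * s"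
  shows "2 * (\<Sum>s = l..h. f s) = (h - l + 1) * (2 * \<alpha> + \<beta> * (h + l))"
proof -
  have "l - 1 \<le> h" using assms(1) by simp
  then have "2 * (\<Sum>s = l..h. \<alpha> + \<beta> * s) = (h - l + 1) * (2 * \<alpha> + \<beta> * (h + l))"
  proof (induction rule: int_ge_induct)
    case base
    then show ?case by simp
  next
    case (step h)
    have "{l..h + 1} = insert (h + 1) {l..h}" using step.hyps by auto
    then have "(\<Sum>s = l..h + 1. \<alpha> + \<beta> * s) = \<alpha> + \<beta> * (h + 1) + (\<Sum>s = l..h. \<alpha> + \<beta> * s)"
      by simp
    then show ?case using step.IH by (simp add: algebra_simps)
  qed
  moreover have "(\<Sum>s = l..h. f s) = (\<Sum>s = l..h. \<alpha> + \<beta> * s)"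
    by (rule sum.cong) (use f in auto)
  ultimately show ?thesis by simp
qed

lemma sum_split_int:
  fixes l m h :: int
  assumes "l \<le> m + 1" "m \<le> h"
  shows "sum f {l..h} = sum f {l..m} + sum f {m + 1..h}"
proof -
  have "{l..h} = {l..m} \<union> {m + 1..h}" using assms by auto
  then show ?thesis by (simp add: sum.union_disjoint)
qed

lemma sum_squares_int:
  fixes n :: int
  assumes "0 \<le> n"
  shows "6 * (\<Sum>s = 0..<n. s\<^sup>2) = (n - 1) * n * (2 * n - 1)"
  using assms
proof (induction rule: int_ge_induct)
  case base
  then show ?case by simp
next
  case (step n)
  have "{0..<n + 1} = insert n {0..<n}" using step.hyps by auto
  then show ?case using step.IH by (simp add: algebra_simps power2_eq_square)
qed

section \<open>The sum of the gaps from an Apery set\<close>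

text \<open>The elements of the class of \<open>w s\<close> to be summed are
  \<open>w s - t * a\<close> with \<open>1 \<le> t \<le> w s div a\<close>. When \<open>w\<close>
  lists the Apery set of \<open>a\<close>, this is the classical formula
  \<open>sum w^2 / (2 a) - sum w / 2 + (a^2 - 1) / 12\<close> for the Sylvester sum, cleared of
  denominators.\<close>

lemma sum_gaps:
  fixes a :: int and w :: "int \<Rightarrow> int"
  assumes "a > 0" and bij: "bij_betw (\<lambda>s. w s mod a) I {0..<a}" and pos: "\<And>s. s \<in> I \<Longrightarrow> 0 \<le> w s"
  shows "12 * a * (\<Sum>n | 0 \<le> n \<and> (\<exists>s\<in>I. n mod a = w s mod a \<and> n < w s). n)
    = 6 * (\<Sum>s\<in>I. (w s)\<^sup>2 - a * w s) + a * (a\<^sup>2 - 1)"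
proof -
  let ?N = "{n. 0 \<le> n \<and> (\<exists>s\<in>I. n mod a = w s mod a \<and> n < w s)}"
  define g where "g = (\<lambda>s. w s mod a)"
  have fin: "finite I" using bij bij_betw_finite by blast
  have inj: "inj_on g I" and im: "g ` I = {0..<a}" using bij by (simp_all add: bij_betw_def g_def)
  let ?T = "SIGMA s:I. {1..w s div a}"
  let ?h = "\<lambda>(s, t). w s - t * a"
  have injh: "inj_on ?h ?T"
  proof (rule inj_onI, clarsimp)
    fix s t s' t'
    assume s: "s \<in> I" "s' \<in> I" and e: "w s - t * a = w s' - t' * a"
    have "(w s - t * a) mod a = w s mod a" "(w s' - t' * a) mod a = w s' mod a"
      by (simp_all add: mod_diff_eq flip: mod_diff_right_eq)
    then have "g s = g s'" using e by (simp add: g_def)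
    then have "s = s'" using inj s by (auto dest: inj_onD)
    then show "s = s' \<and> t = t'" using e \<open>a > 0\<close> by simp
  qed
  have imh: "?h ` ?T = ?N"
  proof (intro equalityI subsetI)
    fix n assume "n \<in> ?h ` ?T"
    then obtain s t where st: "s \<in> I" "1 \<le> t" "t \<le> w s div a" "n = w s - t * a" by auto
    have "t * a \<le> w s div a * a" using st(3) \<open>a > 0\<close> by simp
    also have "\<dots> \<le> w s" using \<open>a > 0\<close> by (metis div_mult_mod_eq le_add_same_cancel1 pos_mod_sign)
    finally have "0 \<le> n" using st by simp
    moreover have "n < w s" using st \<open>a > 0\<close> by simp
    moreover have "n mod a = w s mod a" using st(4) by (simp flip: mod_diff_right_eq)
    ultimately show "n \<in> ?N" using st(1) by blast
  next
    fix n assume "n \<in> ?N"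
    then obtain s where s: "0 \<le> n" "s \<in> I" "n mod a = w s mod a" "n < w s" by auto
    then have "a dvd w s - n" by (metis mod_eq_dvd_iff)
    then obtain t where t: "w s - n = a * t" by (elim dvdE)
    have "0 < a * t" using s t by simp
    then have "1 \<le> t" using \<open>a > 0\<close> by (simp add: zero_less_mult_iff)
    moreover have "t \<le> w s div a"
    proof -
      have "t * a \<le> w s" using t s(1) by (simp add: algebra_simps)
      then show ?thesis using zdiv_mono1[of "t * a" "w s" a] \<open>a > 0\<close> by simp
    qed
    moreover have "n = w s - t * a" using t by (simp add: algebra_simps)
    ultimately show "n \<in> ?h ` ?T" using s(2) by (intro image_eqI[of _ _ "(s, t)"]) auto
  qed
  \<comment> \<open>With \<open>w s = a * Q + g s\<close>, the arithmetic progression sums to the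
    difference of the values of \<open>x^2 - a x\<close> at \<open>w s\<close> and at its residue
    \<open>g s\<close>. As \<open>g\<close> takes every residue once, the second part contributes a
    constant depending on \<open>a\<close> alone.\<close>
  have term_eq: "2 * a * (\<Sum>t = 1..w s div a. w s - t * a) = ((w s)\<^sup>2 - a * w s) - ((g s)\<^sup>2 - a * g s)"
    if "s \<in> I" for s
  proof -
    define Q where "Q = w s div a"
    have ws: "w s = a * Q + g s" by (simp add: Q_def g_def)
    have "0 \<le> Q" using pos[OF that] \<open>a > 0\<close> by (simp add: Q_def pos_imp_zdiv_nonneg_iff)
    then have "2 * (\<Sum>t = 1..Q. w s - t * a) = (Q - 1 + 1) * (2 * w s + (- a) * (Q + 1))"
      by (intro sum_affine_int) auto
    then have "2 * a * (\<Sum>t = 1..Q. w s - t * a) = a * (Q * (2 * w s + (- a) * (Q + 1)))"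
      by simp
    also have "\<dots> = ((w s)\<^sup>2 - a * w s) - ((g s)\<^sup>2 - a * g s)"
      unfolding ws by (simp add: algebra_simps power2_eq_square)
    finally show ?thesis by (simp add: Q_def)
  qed
  have "(\<Sum>n\<in>?N. n) = (\<Sum>x\<in>?T. ?h x)"
    unfolding imh[symmetric] using sum.reindex[OF injh, of "\<lambda>x. x"] by (simp add: o_def)
  also have "\<dots> = (\<Sum>s\<in>I. \<Sum>t = 1..w s div a. w s - t * a)"
    by (subst sum.Sigma) (auto simp: fin)
  finally have "2 * a * (\<Sum>n\<in>?N. n) = (\<Sum>s\<in>I. 2 * a * (\<Sum>t = 1..w s div a. w s - t * a))"
    by (simp add: sum_distrib_left)
  also have "\<dots> = (\<Sum>s\<in>I. (w s)\<^sup>2 - a * w s) - (\<Sum>s\<in>I. (g s)\<^sup>2 - a * g s)"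
    using term_eq by (simp add: sum_subtractf[symmetric])
  also have "(\<Sum>s\<in>I. (g s)\<^sup>2 - a * g s) = (\<Sum>\<rho> = 0..<a. \<rho>\<^sup>2 - a * \<rho>)"
    unfolding im[symmetric] using sum.reindex[OF inj, of "\<lambda>\<rho>. \<rho>\<^sup>2 - a * \<rho>"] by (simp add: o_def)
  finally have main: "2 * a * (\<Sum>n\<in>?N. n) = (\<Sum>s\<in>I. (w s)\<^sup>2 - a * w s) - (\<Sum>\<rho> = 0..<a. \<rho>\<^sup>2 - a * \<rho>)" .
  have "2 * (\<Sum>\<rho> = 0..a - 1. \<rho>) = (a - 1 - 0 + 1) * (2 * 0 + 1 * (a - 1 + 0))"
    using \<open>a > 0\<close> by (intro sum_affine_int) auto
  moreover have "{0..a - 1} = {0..<a}" by auto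
  ultimately have lin: "2 * (\<Sum>\<rho> = 0..<a. \<rho>) = a * (a - 1)" by simp
  have "6 * (\<Sum>\<rho> = 0..<a. \<rho>\<^sup>2 - a * \<rho>) = 6 * (\<Sum>\<rho> = 0..<a. \<rho>\<^sup>2) - 3 * a * (2 * (\<Sum>\<rho> = 0..<a. \<rho>))"
    by (simp add: sum_subtractf sum_distrib_left)
  also have "\<dots> = - a * (a\<^sup>2 - 1)"
    using \<open>a > 0\<close> sum_squares_int[of a] unfolding lin by (simp add: algebra_simps power2_eq_square)
  finally show ?thesis using main by simp
qed

section \<open>The semigroup spanned by the generators\<close>

text \<open>\<open>a_eq\<close> and \<open>r_bounds\<close> make \<open>q\<close> and
  \<open>r\<close> the quotient and remainder of \<open>a + K\<close> by \<open>k\<close>;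
  \<open>K_lower\<close> and \<open>K_upper\<close> are the integer forms of
  \<open>(k - 1) / 2 < K \<le> (2 k - 2) / 3\<close>.\<close>

locale progression_generators =
  fixes a d K k q r :: int
  assumes d_pos: "0 < d" and coprime: "coprime a d" and K_pos: "0 < K"
    and K_lower: "k \<le> 2 * K" and K_upper: "3 * K \<le> 2 * k - 2"
    and a_eq: "a = q * k + r - K" and q_ge: "2 \<le> q" and r_bounds: "0 \<le> r" "r < k"
begin

lemma K_less: "K < k - 1"
  using K_upper K_pos K_lower by linarith

text \<open>Since \<open>q \<ge> 2\<close>, \<open>a \<ge> 2 k - K\<close>. The bound places both
  gaps \<open>{1..K}\<close> and \<open>{k + 1..2 * K + 1}\<close> below \<open>a\<close>, and a
  shift by \<open>a\<close> carries their elements past both gaps.\<close>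

lemma a_ge: "2 * K + 2 \<le> a"
proof -
  have "2 * k \<le> q * k" using q_ge K_less K_pos by (intro mult_right_mono) auto
  then show ?thesis using a_eq r_bounds K_upper by linarith
qed

definition gens :: "int list" where
  "gens = a # map (\<lambda>j. a + j * d) [K + 1..k]"

inductive rep :: "int \<Rightarrow> bool" where
  rep_0: "rep 0"
| rep_add: "rep n \<Longrightarrow> g \<in> set gens \<Longrightarrow> rep (n + g)"

text \<open>The bounds say exactly that \<open>J\<close> is a sum of \<open>N\<close> integers from \<open>{K + 1..k}\<close>.\<close>

definition attains :: "int \<Rightarrow> int \<Rightarrow> bool" where
  "attains N J \<longleftrightarrow> 0 \<le> N \<and> N * (K + 1) \<le> J \<and> J \<le> N * k"

text \<open>This is the ceiling of \<open>J / k\<close>: for \<open>J \<ge> 0\<close>, the least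
  number of summands, each at most \<open>k\<close>, that can reach \<open>J\<close>.\<close>

definition parts :: "int \<Rightarrow> int" where
  "parts J = (J + k - 1) div k"

lemma parts_eq_iff: "parts J = v \<longleftrightarrow> (v - 1) * k < J \<and> J \<le> v * k"
proof
  have kp: "k > 0" using K_less K_pos by simp
  show "(v - 1) * k < J \<and> J \<le> v * k" if "parts J = v"
  proof -
    have "J + k - 1 = v * k + (J + k - 1) mod k" using that by (auto simp: parts_def)
    moreover have "0 \<le> (J + k - 1) mod k" "(J + k - 1) mod k < k" using kp by simp_all
    ultimately show ?thesis by (simp add: left_diff_distrib)
  qed
  show "parts J = v" if "(v - 1) * k < J \<and> J \<le> v * k"
    unfolding parts_def
    by (rule int_div_pos_eq[where r = "J + k - 1 - v * k"]) (use that in \<open>auto simp: algebra_simps\<close>)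
qed

lemma parts_mono: "J \<le> J' \<Longrightarrow> parts J \<le> parts J'"
  using K_less K_pos by (simp add: parts_def zdiv_mono1)

lemma parts_bounds: "(parts J - 1) * k < J" "J \<le> parts J * k"
  using parts_eq_iff[of J "parts J"] by auto

lemma attains_imp_parts_le:
  assumes "attains N J" shows "parts J \<le> N"
proof -
  have "parts J \<le> parts (N * k)" using assms by (auto simp: attains_def intro: parts_mono)
  also have "parts (N * k) = N" using K_less K_pos by (simp add: parts_eq_iff left_diff_distrib)
  finally show ?thesis .
qed

lemma rep_attains:
  assumes "attains N J" "0 \<le> x"
  shows "rep ((x + N) * a + J * d)"
proof -
  have step: "rep (m + int i * a)" if "rep m" for m i
  proof (induction i)
    case (Suc i)
    have "a \<in> set gens" by (simp add: gens_def)
    from rep_add[OF Suc this] show ?case by (simp add: algebra_simps)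
  qed (simp add: that)
  have "rep (int M * a + J * d)" if "attains (int M) J" for M J
    using that
  proof (induction M arbitrary: J)
    case 0
    then have "J = 0" by (simp add: attains_def)
    then show ?case using rep_0 by simp
  next
    case (Suc M)
    \<comment> \<open>The smallest admissible summand that leaves a remainder of at most
      \<open>M * k\<close> for the other \<open>M\<close> summands.\<close>
    define j where "j = max (K + 1) (J - int M * k)"
    have j: "K + 1 \<le> j" "j \<le> k" using Suc.prems K_less by (auto simp: j_def attains_def algebra_simps)
    have "attains (int M) (J - j)"
    proof -
      have "int M * (K + 1) \<le> int M * k" using K_less by (intro mult_left_mono) auto
      then show ?thesis using Suc.prems by (auto simp: j_def attains_def algebra_simps max_def)
    qed
    then have "rep (int M * a + (J - j) * d)" by (rule Suc.IH)
    moreover have "a + j * d \<in> set gens" using j by (auto simp: gens_def)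
    ultimately have "rep (int M * a + (J - j) * d + (a + j * d))" by (rule rep_add)
    then show ?case by (simp add: algebra_simps)
  qed
  from step[OF this[of "nat N" J], of "nat x"] show ?thesis
    using assms by (simp add: attains_def algebra_simps)
qed

text \<open>\<open>x\<close> counts the copies of \<open>a\<close> and \<open>N\<close> the other
  generators, whose multiples of \<open>d\<close> add up to \<open>J * d\<close>.\<close>

lemma rep_iff_attains: "rep n \<longleftrightarrow> (\<exists>x N J. 0 \<le> x \<and> attains N J \<and> n = (x + N) * a + J * d)"
proof
  assume "rep n"
  then show "\<exists>x N J. 0 \<le> x \<and> attains N J \<and> n = (x + N) * a + J * d"
  proof induction
    case rep_0
    show ?case by (intro exI[of _ 0]) (simp add: attains_def)
  next
    case (rep_add n g)
    then obtain x N J where n: "0 \<le> x" "attains N J" "n = (x + N) * a + J * d" by blast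
    consider "g = a" | j where "K + 1 \<le> j" "j \<le> k" "g = a + j * d"
      using rep_add.hyps by (auto simp: gens_def)
    then show ?case
    proof cases
      case 1
      have "n + g = (x + 1 + N) * a + J * d" using n 1 by (simp add: algebra_simps)
      moreover have "0 \<le> x + 1" using n by simp
      ultimately show ?thesis using n by blast
    next
      case 2
      have "n + g = (x + (N + 1)) * a + (J + j) * d" using n 2 by (simp add: algebra_simps)
      moreover have "attains (N + 1) (J + j)" using n 2 by (simp add: attains_def algebra_simps)
      ultimately show ?thesis using n by blast
    qed
  qed
qed (use rep_attains in blast)

text \<open>Ties the inductive predicate, which suits adding one generator at a time, to the
  coefficient vectors in \<open>NR\<close>.\<close>

lemma rep_iff_sum:
  "rep n \<longleftrightarrow> (\<exists>x :: nat \<Rightarrow> int. (\<forall>i < length gens. x i \<ge> 0) \<and> n = (\<Sum>i < length gens. x i * gens ! i))"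
proof
  assume "rep n"
  then show "\<exists>x :: nat \<Rightarrow> int. (\<forall>i < length gens. x i \<ge> 0) \<and> n = (\<Sum>i < length gens. x i * gens ! i)"
  proof induction
    case rep_0
    show ?case by (intro exI[of _ "\<lambda>_. 0"]) simp
  next
    case (rep_add n g)
    then obtain x j where x: "\<forall>i < length gens. x i \<ge> (0::int)" "n = (\<Sum>i < length gens. x i * gens ! i)"
      and j: "j < length gens" "g = gens ! j" by (auto simp: in_set_conv_nth)
    have "(\<Sum>i < length gens. (x i + (if i = j then 1 else 0)) * gens ! i)
        = (\<Sum>i < length gens. x i * gens ! i + (if i = j then gens ! j else 0))"
      by (rule sum.cong) (auto simp: algebra_simps)
    also have "\<dots> = n + g" using x j by (simp add: sum.distrib)
    finally show ?case using x by (intro exI[of _ "\<lambda>i. x i + (if i = j then 1 else 0)"]) auto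
  qed
next
  have add: "rep (m + int t * g)" if "rep m" "g \<in> set gens" for m g t
  proof (induction t)
    case (Suc t)
    from rep_add[OF Suc that(2)] show ?case by (simp add: algebra_simps)
  qed (simp add: that)
  assume "\<exists>x :: nat \<Rightarrow> int. (\<forall>i < length gens. x i \<ge> 0) \<and> n = (\<Sum>i < length gens. x i * gens ! i)"
  then obtain x :: "nat \<Rightarrow> int" where x: "\<forall>i < length gens. x i \<ge> 0" "n = (\<Sum>i < length gens. x i * gens ! i)"
    by blast
  have "rep (\<Sum>i < m. x i * gens ! i)" if "m \<le> length gens" for m
    using that
  proof (induction m)
    case 0
    then show ?case using rep_0 by simp
  next
    case (Suc m)
    then have "rep ((\<Sum>i < m. x i * gens ! i) + int (nat (x m)) * gens ! m)" by (intro add) auto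
    then show ?case using x(1) Suc.prems by simp
  qed
  then show "rep n" using x(2) by simp
qed

section \<open>The Apery set of \<open>a\<close>\<close>

text \<open>Among the \<open>s + i a\<close> with \<open>i \<ge> 0\<close>, \<open>first s\<close> is the least sum of integers from \<open>{K + 1..k}\<close>.\<close>

definition first :: "int \<Rightarrow> int" where
  "first s = (if s \<in> {1..K} \<union> {k + 1..2 * K + 1} then s + a else s)"

definition apery :: "int \<Rightarrow> int" where
  "apery s = parts (first s) * a + first s * d"

text \<open>No summand gives 0, one gives \<open>{K + 1..k}\<close>, and two or more give at least
  \<open>2 * K + 2\<close>.\<close>

lemma attains_gap:
  assumes "attains N J"
  shows "J \<notin> {1..K} \<union> {k + 1..2 * K + 1}"
proof -
  have N: "0 \<le> N" "N * (K + 1) \<le> J" "J \<le> N * k" using assms by (auto simp: attains_def)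
  consider "N = 0" | "N = 1" | "2 \<le> N" using N(1) by linarith
  then show ?thesis
  proof cases
    case 3
    then have "2 * (K + 1) \<le> N * (K + 1)" using K_pos by (intro mult_right_mono) auto
    then show ?thesis using N K_lower by auto
  qed (use N K_less K_pos in auto)
qed

text \<open>Converse of \<open>attains_gap\<close>, realised with the fewest summands. For
  \<open>c = parts J\<close> the upper bound \<open>J \<le> c * k\<close> is automatic, so the work
  lies in \<open>c * (K + 1) \<le> J\<close>.\<close>

lemma attains_parts:
  assumes "0 \<le> J" "J \<notin> {1..K} \<union> {k + 1..2 * K + 1}"
  shows "attains (parts J) J"
proof -
  have k: "k > 0" using K_less K_pos by simp
  consider "J = 0" | "K + 1 \<le> J" "J \<le> k" | "2 * K + 2 \<le> J" using assms by force
  then show ?thesis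
  proof cases
    case 1
    then have "parts J = 0" using k by (simp add: parts_eq_iff)
    then show ?thesis using 1 by (simp add: attains_def)
  next
    case 2
    then have "parts J = 1" using K_pos by (simp add: parts_eq_iff)
    then show ?thesis using 2 by (simp add: attains_def)
  next
    case 3
    define c where "c = parts J"
    have c: "(c - 1) * k < J" "J \<le> c * k" using parts_bounds by (auto simp: c_def)
    have "1 * k < c * k" using 3 K_lower c by linarith
    then have "2 \<le> c" using k by (simp only: mult_less_cancel_right) auto
    moreover have "c * (K + 1) \<le> J"
    proof (cases "c = 2")
      \<comment> \<open>Here \<open>c \<ge> 3\<close>. As \<open>J \<ge> (c - 1) * k + 1\<close>, it
        suffices that \<open>c * (k - K - 1) \<ge> k - 1\<close>, and for \<open>c = 3\<close> this
        is exactly \<open>K_upper\<close>.\<close>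
      case False
      then have "3 * (k - K - 1) \<le> c * (k - K - 1)" using \<open>2 \<le> c\<close> K_less by (intro mult_right_mono) auto
      moreover have "k - 1 \<le> 3 * (k - K - 1)" using K_upper by simp
      ultimately have "k - 1 \<le> c * (k - K - 1)" by (rule order_trans[rotated])
      then show ?thesis using c by (simp add: algebra_simps)
    qed (use 3 in auto)
    ultimately show ?thesis using c by (simp add: attains_def c_def)
  qed
qed

lemma attains_first:
  assumes "0 \<le> s" "s < a"
  shows "attains (parts (first s)) (first s)"
proof (rule attains_parts)
  show "0 \<le> first s" using assms by (simp add: first_def)
  show "first s \<notin> {1..K} \<union> {k + 1..2 * K + 1}" using a_ge assms K_lower by (auto simp: first_def)
qed

text \<open>A negative \<open>i\<close> would make the total negative, and for \<open>s\<close> in a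
  gap \<open>attains_gap\<close> rules out \<open>i = 0\<close>.\<close>

lemma first_le:
  assumes "attains N (s + i * a)" "0 \<le> s" "s < a"
  shows "first s \<le> s + i * a"
proof -
  have "0 \<le> N * (K + 1)" using assms(1) K_pos by (simp add: attains_def)
  then have "0 \<le> s + i * a" using assms(1) by (simp add: attains_def)
  have "0 \<le> i"
  proof (rule ccontr)
    assume "\<not> 0 \<le> i"
    then have "i * a \<le> (-1) * a" using assms by (intro mult_right_mono) auto
    then show False using \<open>0 \<le> s + i * a\<close> assms by simp
  qed
  show ?thesis
  proof (cases "s \<in> {1..K} \<union> {k + 1..2 * K + 1}")
    case True
    then have "i \<noteq> 0" using attains_gap[OF assms(1)] by auto
    then have "1 * a \<le> i * a" using \<open>0 \<le> i\<close> assms by (intro mult_right_mono) auto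
    then show ?thesis using True by (simp add: first_def)
  next
    case False
    have "0 \<le> i * a" using \<open>0 \<le> i\<close> assms by simp
    moreover have "first s = s" using False by (simp only: first_def if_False)
    ultimately show ?thesis by simp
  qed
qed

lemma apery_mod: "apery s mod a = s * d mod a"
proof -
  have "first s mod a = s mod a" by (simp add: first_def)
  then show ?thesis unfolding apery_def by (metis mod_mult_self3 mod_mult_left_eq)
qed

text \<open>Coprimality turns the congruence into \<open>J = s + i * a\<close>. Since
  \<open>parts\<close> is monotone, the least total \<open>first s\<close> also needs the fewest
  summands, so both terms of \<open>apery s\<close> are minimal at once. Conversely, a surplus over
  \<open>apery s\<close> is a multiple of \<open>a\<close>, filled by copies of the generator
  \<open>a\<close>.\<close>

lemma rep_iff_apery_le:
  assumes "0 \<le> s" "s < a" "n mod a = apery s mod a"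
  shows "rep n \<longleftrightarrow> apery s \<le> n"
proof
  assume "rep n"
  then obtain x N J where n: "0 \<le> x" "attains N J" "n = (x + N) * a + J * d"
    by (auto simp: rep_iff_attains)
  have "J * d mod a = s * d mod a" using assms(3) by (simp add: n apery_mod)
  then have "a dvd (J - s) * d" by (simp add: mod_eq_dvd_iff left_diff_distrib)
  then have "a dvd J - s" using coprime by (simp add: coprime_dvd_mult_left_iff)
  then obtain i where i: "J = s + i * a" by (metis dvdE add.commute diff_add_cancel mult.commute)
  have J: "first s \<le> J" using first_le n(2) assms i by blast
  then have "parts (first s) \<le> N" using parts_mono attains_imp_parts_le[OF n(2)] order_trans by blast
  then have "parts (first s) * a \<le> (x + N) * a" using n(1) assms by (intro mult_right_mono) auto
  moreover have "first s * d \<le> J * d" using J d_pos by simp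
  ultimately show "apery s \<le> n" by (simp add: apery_def n)
next
  assume le: "apery s \<le> n"
  from assms(3) have "a dvd n - apery s" by (simp add: mod_eq_dvd_iff)
  then obtain x where x: "n - apery s = a * x" by (elim dvdE)
  then have "0 \<le> x" using le assms by (smt (verit) zero_le_mult_iff)
  have "n = (x + parts (first s)) * a + first s * d" using x by (simp add: apery_def algebra_simps)
  then show "rep n" using rep_attains[OF attains_first[OF assms(1,2)] \<open>0 \<le> x\<close>] by simp
qed

lemma apery_nonneg:
  assumes "0 \<le> s" "s < a"
  shows "0 \<le> apery s"
proof -
  have "0 \<le> first s" "0 \<le> parts (first s)" using attains_first[OF assms] assms
    by (auto simp: attains_def first_def)
  then show ?thesis using assms d_pos by (simp add: apery_def)
qed

lemma bij_betw_apery_mod: "bij_betw (\<lambda>s. apery s mod a) {0..<a} {0..<a}"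
proof -
  have "a > 0" using a_ge K_pos by simp
  have inj: "inj_on (\<lambda>s. apery s mod a) {0..<a}"
  proof (rule inj_onI)
    fix s t assume st: "s \<in> {0..<a}" "t \<in> {0..<a}" "apery s mod a = apery t mod a"
    then have "a dvd (s - t) * d" by (simp add: apery_mod mod_eq_dvd_iff left_diff_distrib)
    then have "a dvd s - t" using coprime by (simp add: coprime_dvd_mult_left_iff)
    then have "s mod a = t mod a" by (simp add: mod_eq_dvd_iff)
    then show "s = t" using st by simp
  qed
  have "(\<lambda>s. apery s mod a) ` {0..<a} \<subseteq> {0..<a}" using \<open>a > 0\<close> by auto
  then have "(\<lambda>s. apery s mod a) ` {0..<a} = {0..<a}" using endo_inj_surj inj by blast
  then show ?thesis using inj by (simp add: bij_betw_def)
qed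

lemma sylvester_sum_gens:
  "12 * a * sylvester_sum gens = 6 * (\<Sum>s = 0..<a. (apery s)\<^sup>2 - a * apery s) + a * (a\<^sup>2 - 1)"
proof -
  have "a > 0" using a_ge K_pos by simp
  have "NR gens = {n. 0 \<le> n \<and> (\<exists>s\<in>{0..<a}. n mod a = apery s mod a \<and> n < apery s)}"
  proof (intro set_eqI iffI)
    fix n assume "n \<in> NR gens"
    then have n: "0 < n" "\<not> rep n" by (auto simp: NR_def rep_iff_sum)
    have "n mod a \<in> (\<lambda>s. apery s mod a) ` {0..<a}"
      using bij_betw_apery_mod \<open>a > 0\<close> by (simp add: bij_betw_def)
    then obtain s where "s \<in> {0..<a}" "n mod a = apery s mod a" by auto
    then show "n \<in> {n. 0 \<le> n \<and> (\<exists>s\<in>{0..<a}. n mod a = apery s mod a \<and> n < apery s)}"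
      using n rep_iff_apery_le by force
  next
    fix n assume "n \<in> {n. 0 \<le> n \<and> (\<exists>s\<in>{0..<a}. n mod a = apery s mod a \<and> n < apery s)}"
    then have "0 \<le> n" "\<not> rep n" using rep_iff_apery_le by force+
    \<comment> \<open>\<open>NR\<close> contains only positive integers, while the set of gaps
      admits 0; the two agree because 0 is the empty sum.\<close>
    moreover from this have "n \<noteq> 0" using rep_0 by auto
    ultimately show "n \<in> NR gens" by (simp add: NR_def rep_iff_sum)
  qed
  moreover have "12 * a * (\<Sum>n | 0 \<le> n \<and> (\<exists>s\<in>{0..<a}. n mod a = apery s mod a \<and> n < apery s). n)
    = 6 * (\<Sum>s = 0..<a. (apery s)\<^sup>2 - a * apery s) + a * (a\<^sup>2 - 1)"
    using \<open>a > 0\<close> bij_betw_apery_mod apery_nonneg by (intro sum_gaps) auto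
  ultimately show ?thesis by (simp add: sylvester_sum_def)
qed

section \<open>Moments of the Apery set\<close>

text \<open>A full sum plus a correction for the two shifted gaps. Dropping \<open>s = 0\<close>
  aligns the range with the blocks \<open>{p * k + 1..p * k + k}\<close> on which
  \<open>parts\<close> is constant.\<close>

lemma sum_first:
  assumes "\<phi> 0 = (0::int)"
  shows "(\<Sum>s = 0..<a. \<phi> (first s)) = (\<Sum>s = 1..a - 1. \<phi> s)
    + (\<Sum>s = 1..K. \<phi> (s + a) - \<phi> s) + (\<Sum>s = k + 1..2 * K + 1. \<phi> (s + a) - \<phi> s)"
proof -
  let ?B = "{1..K} \<union> {k + 1..2 * K + 1}"
  have sub: "?B \<subseteq> {1..a - 1}" using a_ge K_pos K_less by auto
  have "first 0 = 0" using K_pos K_less by (simp add: first_def)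
  moreover have "{0..<a} = insert 0 {1..a - 1}" using a_ge K_pos by auto
  ultimately have "(\<Sum>s = 0..<a. \<phi> (first s)) = (\<Sum>s = 1..a - 1. \<phi> (first s))"
    using assms by simp
  also have "\<dots> = (\<Sum>s = 1..a - 1. \<phi> s + (if s \<in> ?B then \<phi> (s + a) - \<phi> s else 0))"
    by (rule sum.cong) (auto simp: first_def)
  also have "\<dots> = (\<Sum>s = 1..a - 1. \<phi> s) + (\<Sum>s\<in>?B. \<phi> (s + a) - \<phi> s)"
    using sub by (simp only: sum.distrib sum.inter_restrict[symmetric] finite_atLeastAtMost_int Int_absorb1)
  also have "(\<Sum>s\<in>?B. \<phi> (s + a) - \<phi> s)
      = (\<Sum>s = 1..K. \<phi> (s + a) - \<phi> s) + (\<Sum>s = k + 1..2 * K + 1. \<phi> (s + a) - \<phi> s)"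
    using K_less by (intro sum.union_disjoint) auto
  finally show ?thesis by simp
qed

lemma parts_in_block: "p * k < s \<Longrightarrow> s \<le> p * k + k \<Longrightarrow> parts s = p + 1"
  by (simp add: parts_eq_iff algebra_simps)

text \<open>For \<open>w = p * a + J * d\<close>, the expression \<open>w^2 - a w\<close> equals
  \<open>a^2 (p^2 - p) + a d (2 p - 1) J + d^2 J^2\<close>. The two sums are the first two of these
  moments over \<open>n\<close> full blocks.\<close>

lemma sum_parts_blocks:
  "3 * (\<Sum>s = 1..int n * k. (parts s)\<^sup>2 - parts s) = k * (int n + 1) * int n * (int n - 1)"
  "6 * (\<Sum>s = 1..int n * k. (2 * parts s - 1) * s)
    = k\<^sup>2 * int n * (int n - 1) * (4 * int n + 1) + 3 * k * (k + 1) * (int n)\<^sup>2"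
proof (induction n)
  case (Suc n)
  let ?n = "int n"
  have k: "0 \<le> k" "0 \<le> ?n * k" using K_pos K_less by simp_all
  have split: "sum f {1..int (Suc n) * k} = sum f {1..?n * k} + sum f {?n * k + 1..?n * k + k}" for f :: "int \<Rightarrow> int"
    using sum_split_int[of 1 "?n * k" "?n * k + k" f] k by (simp add: algebra_simps)
  have X: "2 * (\<Sum>s = ?n * k + 1..?n * k + k. (parts s)\<^sup>2 - parts s)
      = (?n * k + k - (?n * k + 1) + 1) * (2 * ((?n + 1)\<^sup>2 - (?n + 1)) + 0 * (?n * k + k + (?n * k + 1)))"
    using k by (intro sum_affine_int) (auto simp: parts_in_block[of ?n])
  have Y: "2 * (\<Sum>s = ?n * k + 1..?n * k + k. (2 * parts s - 1) * s)
      = (?n * k + k - (?n * k + 1) + 1) * (2 * 0 + (2 * (?n + 1) - 1) * (?n * k + k + (?n * k + 1)))"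
    using k by (intro sum_affine_int) (auto simp: parts_in_block[of ?n])
  show "3 * (\<Sum>s = 1..int (Suc n) * k. (parts s)\<^sup>2 - parts s)
      = k * (int (Suc n) + 1) * int (Suc n) * (int (Suc n) - 1)"
    using Suc(1) X unfolding split by (simp add: algebra_simps power2_eq_square)
  show "6 * (\<Sum>s = 1..int (Suc n) * k. (2 * parts s - 1) * s)
      = k\<^sup>2 * int (Suc n) * (int (Suc n) - 1) * (4 * int (Suc n) + 1) + 3 * k * (k + 1) * (int (Suc n))\<^sup>2"
    using Suc(2) Y unfolding split by (simp add: algebra_simps power2_eq_square)
qed simp_all

text \<open>After \<open>p\<close> full blocks come \<open>u\<close> further elements, on which
  \<open>parts\<close> is \<open>p + 1\<close>.\<close>

lemma sum_parts:
  assumes "a - 1 = p * k + u" "0 \<le> p" "0 \<le> u" "u \<le> k"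
  shows "3 * (\<Sum>s = 1..a - 1. (parts s)\<^sup>2 - parts s) = k * (p + 1) * p * (p - 1) + 3 * u * p * (p + 1)"
    and "6 * (\<Sum>s = 1..a - 1. (2 * parts s - 1) * s)
      = k\<^sup>2 * p * (p - 1) * (4 * p + 1) + 3 * k * (k + 1) * p\<^sup>2 + 3 * (2 * p + 1) * u * (2 * p * k + u + 1)"
proof -
  have k: "0 \<le> p * k" using K_pos K_less assms by simp
  have split: "sum f {1..a - 1} = sum f {1..p * k} + sum f {p * k + 1..p * k + u}" for f :: "int \<Rightarrow> int"
    using sum_split_int[of 1 "p * k" "p * k + u" f] k assms by simp
  have X: "2 * (\<Sum>s = p * k + 1..p * k + u. (parts s)\<^sup>2 - parts s)
      = (p * k + u - (p * k + 1) + 1) * (2 * ((p + 1)\<^sup>2 - (p + 1)) + 0 * (p * k + u + (p * k + 1)))"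
    using assms by (intro sum_affine_int) (auto simp: parts_in_block[of p])
  have Y: "2 * (\<Sum>s = p * k + 1..p * k + u. (2 * parts s - 1) * s)
      = (p * k + u - (p * k + 1) + 1) * (2 * 0 + (2 * (p + 1) - 1) * (p * k + u + (p * k + 1)))"
    using assms by (intro sum_affine_int) (auto simp: parts_in_block[of p])
  show "3 * (\<Sum>s = 1..a - 1. (parts s)\<^sup>2 - parts s) = k * (p + 1) * p * (p - 1) + 3 * u * p * (p + 1)"
    using sum_parts_blocks(1)[of "nat p"] X assms(2) unfolding split by (simp add: algebra_simps power2_eq_square)
  show "6 * (\<Sum>s = 1..a - 1. (2 * parts s - 1) * s)
      = k\<^sup>2 * p * (p - 1) * (4 * p + 1) + 3 * k * (k + 1) * p\<^sup>2 + 3 * (2 * p + 1) * u * (2 * p * k + u + 1)"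
    using sum_parts_blocks(2)[of "nat p"] Y assms(2) unfolding split by (simp add: algebra_simps power2_eq_square)
qed

text \<open>Since \<open>s + a = q * k + (s + r - K)\<close>, \<open>parts (s + a)\<close> passes
  from \<open>q\<close> to \<open>q + 1\<close> after \<open>s = K - r\<close>, and from
  \<open>q + 1\<close> to \<open>q + 2\<close> after \<open>s = k + K - r\<close>. The cut points
  \<open>m\<close> and \<open>m'\<close> are these values clipped to the first and second
  gap.\<close>

lemma sum_parts_shift:
  assumes m: "m = max 0 (K - r)" and m': "m' = max k (min (2 * K + 1) (k + K - r))"
  shows "(\<Sum>s = 1..K. ((parts (s + a))\<^sup>2 - parts (s + a)) - ((parts s)\<^sup>2 - parts s))
      = m * (q\<^sup>2 - q) + (K - m) * (q\<^sup>2 + q)"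
    and "2 * (\<Sum>s = 1..K. (2 * parts (s + a) - 1) * (s + a) - (2 * parts s - 1) * s)
      = m * (2 * (2 * q - 1) * a + (2 * q - 2) * (m + 1))
        + (K - m) * (2 * (2 * q + 1) * a + 2 * q * (K + m + 1))"
    and "(\<Sum>s = k + 1..2 * K + 1. ((parts (s + a))\<^sup>2 - parts (s + a)) - ((parts s)\<^sup>2 - parts s))
      = (m' - k) * (q\<^sup>2 + q - 2) + (2 * K + 1 - m') * (q\<^sup>2 + 3 * q)"
    and "2 * (\<Sum>s = k + 1..2 * K + 1. (2 * parts (s + a) - 1) * (s + a) - (2 * parts s - 1) * s)
      = (m' - k) * (2 * (2 * q + 1) * a + (2 * q - 2) * (m' + k + 1))
        + (2 * K + 1 - m') * (2 * (2 * q + 3) * a + 2 * q * (2 * K + m' + 2))"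
proof -
  have bd: "0 \<le> m" "m \<le> K" "k \<le> m'" "m' \<le> 2 * K + 1"
    using m m' r_bounds K_pos K_lower by auto
  have s1: "parts s = 1" if "1 \<le> s" "s \<le> K" for s
    using parts_in_block[of 0 s] that K_less by simp
  have s2: "parts s = 2" if "k + 1 \<le> s" "s \<le> 2 * K + 1" for s
    using parts_in_block[of 1 s] that K_less by simp
  have a1: "parts (s + a) = q" if "1 \<le> s" "s \<le> m" for s
    using that r_bounds K_less by (auto simp: parts_eq_iff a_eq m left_diff_distrib)
  have a2: "parts (s + a) = q + 1" if "m + 1 \<le> s" "s \<le> K" for s
    using that r_bounds K_less by (auto simp: parts_eq_iff a_eq m distrib_right)
  have a3: "parts (s + a) = q + 1" if "k + 1 \<le> s" "s \<le> m'" for s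
    using that r_bounds K_less by (auto simp: parts_eq_iff a_eq m' distrib_right)
  have a4: "parts (s + a) = q + 2" if "m' + 1 \<le> s" "s \<le> 2 * K + 1" for s
    using that r_bounds K_less by (auto simp: parts_eq_iff a_eq m' algebra_simps)
  have split1: "sum f {1..K} = sum f {1..m} + sum f {m + 1..K}" for f :: "int \<Rightarrow> int"
    using bd by (intro sum_split_int) auto
  have split2: "sum f {k + 1..2 * K + 1} = sum f {k + 1..m'} + sum f {m' + 1..2 * K + 1}" for f :: "int \<Rightarrow> int"
    using bd by (intro sum_split_int) auto
  let ?f = "\<lambda>s. ((parts (s + a))\<^sup>2 - parts (s + a)) - ((parts s)\<^sup>2 - parts s)"
  let ?g = "\<lambda>s. (2 * parts (s + a) - 1) * (s + a) - (2 * parts s - 1) * s"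
  have "2 * sum ?f {1..m} = (m - 1 + 1) * (2 * (q\<^sup>2 - q) + 0 * (m + 1))"
    using bd by (intro sum_affine_int) (auto simp: s1 a1)
  moreover have "2 * sum ?f {m + 1..K} = (K - (m + 1) + 1) * (2 * (q\<^sup>2 + q) + 0 * (K + (m + 1)))"
    using bd by (intro sum_affine_int) (auto simp: s1 a2 power2_eq_square algebra_simps)
  ultimately show "sum ?f {1..K} = m * (q\<^sup>2 - q) + (K - m) * (q\<^sup>2 + q)"
    unfolding split1 by (simp add: algebra_simps)
  have "2 * sum ?f {k + 1..m'} = (m' - (k + 1) + 1) * (2 * (q\<^sup>2 + q - 2) + 0 * (m' + (k + 1)))"
    using bd by (intro sum_affine_int) (auto simp: s2 a3 power2_eq_square algebra_simps)
  moreover have "2 * sum ?f {m' + 1..2 * K + 1}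
      = (2 * K + 1 - (m' + 1) + 1) * (2 * (q\<^sup>2 + 3 * q) + 0 * (2 * K + 1 + (m' + 1)))"
    using bd by (intro sum_affine_int) (auto simp: s2 a4 power2_eq_square algebra_simps)
  ultimately show "sum ?f {k + 1..2 * K + 1}
      = (m' - k) * (q\<^sup>2 + q - 2) + (2 * K + 1 - m') * (q\<^sup>2 + 3 * q)"
    unfolding split2 by (simp add: algebra_simps)
  have "2 * sum ?g {1..m} = (m - 1 + 1) * (2 * ((2 * q - 1) * a) + (2 * q - 2) * (m + 1))"
    using bd by (intro sum_affine_int) (auto simp: s1 a1 algebra_simps)
  moreover have "2 * sum ?g {m + 1..K} = (K - (m + 1) + 1) * (2 * ((2 * q + 1) * a) + 2 * q * (K + (m + 1)))"
    using bd by (intro sum_affine_int) (auto simp: s1 a2 algebra_simps)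
  ultimately show "2 * sum ?g {1..K} = m * (2 * (2 * q - 1) * a + (2 * q - 2) * (m + 1))
        + (K - m) * (2 * (2 * q + 1) * a + 2 * q * (K + m + 1))"
    unfolding split1 by (simp add: algebra_simps)
  have "2 * sum ?g {k + 1..m'}
      = (m' - (k + 1) + 1) * (2 * ((2 * q + 1) * a) + (2 * q - 2) * (m' + (k + 1)))"
    using bd by (intro sum_affine_int) (auto simp: s2 a3 algebra_simps)
  moreover have "2 * sum ?g {m' + 1..2 * K + 1}
      = (2 * K + 1 - (m' + 1) + 1) * (2 * ((2 * q + 3) * a) + 2 * q * (2 * K + 1 + (m' + 1)))"
    using bd by (intro sum_affine_int) (auto simp: s2 a4 algebra_simps)
  ultimately show "2 * sum ?g {k + 1..2 * K + 1}
      = (m' - k) * (2 * (2 * q + 1) * a + (2 * q - 2) * (m' + k + 1))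
        + (2 * K + 1 - m') * (2 * (2 * q + 3) * a + 2 * q * (2 * K + m' + 2))"
    unfolding split2 by (simp add: algebra_simps)
qed

text \<open>The coefficient of \<open>d^2\<close> involves no ceilings, hence no \<open>r\<close>,
  and is the same in all three cases.\<close>

lemma sum_first_squares:
  "6 * (\<Sum>s = 0..<a. (first s)\<^sup>2)
    = a * (2 * a\<^sup>2 + 3 * (6 * K - 2 * k + 1) * a + 6 * K * (5 * K + 7) - 6 * k\<^sup>2 - 6 * k + 13)"
proof -
  have "2 * (\<Sum>s = 1..K. (s + a)\<^sup>2 - s\<^sup>2) = (K - 1 + 1) * (2 * a\<^sup>2 + 2 * a * (K + 1))"
    using K_pos by (intro sum_affine_int) (auto simp: power2_eq_square algebra_simps)
  moreover have "2 * (\<Sum>s = k + 1..2 * K + 1. (s + a)\<^sup>2 - s\<^sup>2)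
      = (2 * K + 1 - (k + 1) + 1) * (2 * a\<^sup>2 + 2 * a * (2 * K + 1 + (k + 1)))"
    using K_lower by (intro sum_affine_int) (auto simp: power2_eq_square algebra_simps)
  moreover have "6 * (\<Sum>s = 1..a - 1. s\<^sup>2) = (a - 1) * a * (2 * a - 1)"
  proof -
    have "{0..<a} = insert 0 {1..a - 1}" using a_ge K_pos by auto
    then show ?thesis using sum_squares_int[of a] a_ge K_pos by simp
  qed
  moreover have "(\<Sum>s = 0..<a. (first s)\<^sup>2) = (\<Sum>s = 1..a - 1. s\<^sup>2)
      + (\<Sum>s = 1..K. (s + a)\<^sup>2 - s\<^sup>2) + (\<Sum>s = k + 1..2 * K + 1. (s + a)\<^sup>2 - s\<^sup>2)"
    using sum_first[of "\<lambda>J. J\<^sup>2"] by simp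
  ultimately show ?thesis by (simp add: algebra_simps power2_eq_square)
qed

text \<open>Reduces each case to two polynomial identities, for the part free of \<open>d\<close>
  and for the coefficient of \<open>k * d\<close>. \<open>X\<close> and \<open>Y\<close> are three
  and six times the moments involving \<open>parts\<close>; a common factor \<open>a\<close> is
  cancelled at the end.\<close>

lemma sylvester_sum_expand:
  assumes "a - 1 = p * k + u" "0 \<le> p" "0 \<le> u" "u \<le> k"
    and "m = max 0 (K - r)" and "m' = max k (min (2 * K + 1) (k + K - r))"
    and X: "X = k * (p + 1) * p * (p - 1) + 3 * u * p * (p + 1)
      + 3 * (m * (q\<^sup>2 - q) + (K - m) * (q\<^sup>2 + q)
      + (m' - k) * (q\<^sup>2 + q - 2) + (2 * K + 1 - m') * (q\<^sup>2 + 3 * q))"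
    and Y: "Y = k\<^sup>2 * p * (p - 1) * (4 * p + 1) + 3 * k * (k + 1) * p\<^sup>2 + 3 * (2 * p + 1) * u * (2 * p * k + u + 1)
      + 3 * (m * (2 * (2 * q - 1) * a + (2 * q - 2) * (m + 1))
        + (K - m) * (2 * (2 * q + 1) * a + 2 * q * (K + m + 1))
        + (m' - k) * (2 * (2 * q + 1) * a + (2 * q - 2) * (m' + k + 1))
        + (2 * K + 1 - m') * (2 * (2 * q + 3) * a + 2 * q * (2 * K + m' + 2)))"
    and P: "k\<^sup>2 * (2 * a * X + a\<^sup>2 - 1) = P" and Q: "k * Y = Q"
  shows "12 * k\<^sup>2 * sylvester_sum gens = P + Q * k * d
      + (2 * a\<^sup>2 + 3 * (6 * K - 2 * k + 1) * a + 6 * K * (5 * K + 7) - 6 * k\<^sup>2 - 6 * k + 13) * k\<^sup>2 * d\<^sup>2"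
proof -
  let ?X = "\<Sum>s = 0..<a. (parts (first s))\<^sup>2 - parts (first s)"
  let ?Y = "\<Sum>s = 0..<a. (2 * parts (first s) - 1) * first s"
  let ?Z = "\<Sum>s = 0..<a. (first s)\<^sup>2"
  let ?R = "2 * a\<^sup>2 + 3 * (6 * K - 2 * k + 1) * a + 6 * K * (5 * K + 7) - 6 * k\<^sup>2 - 6 * k + 13"
  note shift = sum_parts_shift[OF assms(5,6)] and full = sum_parts[OF assms(1-4)]
  have "parts 0 = 0" using K_less K_pos by (simp add: parts_eq_iff)
  then have "3 * ?X = X"
    using sum_first[of "\<lambda>J. (parts J)\<^sup>2 - parts J"] shift(1,3) full(1) by (simp add: X)
  have "6 * ?Y = Y"
    using sum_first[of "\<lambda>J. (2 * parts J - 1) * J"] shift(2,4) full(2) by (simp add: Y)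
  have "(\<Sum>s = 0..<a. (apery s)\<^sup>2 - a * apery s) = (\<Sum>s = 0..<a. a\<^sup>2 * ((parts (first s))\<^sup>2 - parts (first s))
      + a * d * ((2 * parts (first s) - 1) * first s) + d\<^sup>2 * (first s)\<^sup>2)"
    by (rule sum.cong) (simp_all add: apery_def algebra_simps power2_eq_square)
  also have "\<dots> = a\<^sup>2 * ?X + a * d * ?Y + d\<^sup>2 * ?Z"
    by (simp add: sum.distrib sum_distrib_left)
  finally have "12 * a * sylvester_sum gens
      = 2 * a\<^sup>2 * (3 * ?X) + a * d * (6 * ?Y) + d\<^sup>2 * (6 * ?Z) + a * (a\<^sup>2 - 1)"
    using sylvester_sum_gens by simp
  also have "\<dots> = 2 * a\<^sup>2 * X + a * d * Y + d\<^sup>2 * (a * ?R) + a * (a\<^sup>2 - 1)"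
    unfolding \<open>3 * ?X = X\<close> \<open>6 * ?Y = Y\<close> sum_first_squares ..
  finally have "a * (12 * k\<^sup>2 * sylvester_sum gens)
      = k\<^sup>2 * (2 * a\<^sup>2 * X + a * d * Y + d\<^sup>2 * (a * ?R) + a * (a\<^sup>2 - 1))"
    by (simp add: mult.assoc mult.left_commute)
  also have "\<dots> = a * (P + Q * k * d + ?R * k\<^sup>2 * d\<^sup>2)"
    by (simp add: P[symmetric] Q[symmetric] algebra_simps power2_eq_square)
  finally show ?thesis using a_ge K_pos by simp
qed

section \<open>Closed forms in the three ranges of \<open>r\<close>\<close>

text \<open>Here \<open>k + K - r \<ge> 2 * K + 1\<close>, so the shifted second gap lies in a
  single block and only the first can be cut, at \<open>K - r\<close>.\<close>

lemma sylvester_sum_small: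
  assumes "r \<le> k - K - 1"
  shows "12 * k ^ 2 * sylvester_sum gens =
      (2 * a ^ 4 + 6 * (3 * K - k) * a ^ 3
        + (30 * K ^ 2 - 7 * k ^ 2 + 12 * k - 6 * (r + 4 * K - 3 * k) * r) * a ^ 2
        + (K ^ 2 * (14 * K + 6 * k) - 4 * K * k * (8 * k - 3) + 12 * k ^ 2 * (k - 1)
           + 4 * r ^ 3 + 6 * (K - 2 * k) * r ^ 2
           - (24 * K ^ 2 - 6 * K * k - 8 * k ^ 2 + 12 * k) * r) * a
        - k ^ 2)
      + (4 * a ^ 3 + 3 * (12 * K - 4 * k + 1) * a ^ 2
           + (6 * K * (10 * K + 7) - (13 * k ^ 2 - 6 * k - 12)
              - 6 * r * (r + 4 * K - 3 * k)) * a
           + 28 * K ^ 3 - K ^ 2 * (27 * k - 39) - K * (7 * k ^ 2 + 45 * k - 12)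
           + 6 * (k - 1) * k * (k + 2)
           + 2 * r ^ 3 - 3 * r ^ 2 * (2 * K + k + 1)
           + r * (- 6 * K * (4 * K - k + 6) + 7 * k ^ 2 + 9 * k - 12)) * k * d
      + (2 * a ^ 2 + 3 * (6 * K - 2 * k + 1) * a + 6 * K * (5 * K + 7) - 6 * k ^ 2 - 6 * k + 13) * k ^ 2 * d ^ 2"
proof -
  have m: "max 0 (K - r) = K - r" "max k (min (2 * K + 1) (k + K - r)) = 2 * K + 1"
    using assms K_lower K_less r_bounds by auto
  show ?thesis
  \<comment> \<open>As \<open>r \<le> K\<close>, the remainder in
    \<open>a - 1 = q * k + (r - K - 1)\<close> is negative, so one block is borrowed.\<close>
  proof (rule sylvester_sum_expand[where p = "q - 1" and u = "k + r - K - 1", OF _ _ _ _ refl refl refl refl])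
    show "a - 1 = (q - 1) * k + (k + r - K - 1)" by (simp add: a_eq algebra_simps)
    show "0 \<le> q - 1" "0 \<le> k + r - K - 1" "k + r - K - 1 \<le> k"
      using assms q_ge K_pos K_lower K_less r_bounds by simp_all
  \<comment> \<open>Once \<open>a\<close> is eliminated, the goals left are the two polynomial
    identities in \<open>q\<close>, \<open>k\<close>, \<open>K\<close> and \<open>r\<close>.\<close>
  qed (unfold m a_eq, algebra+)
qed

text \<open>Both cut points take their unclipped values \<open>K - r\<close> and
  \<open>k + K - r\<close>.\<close>

lemma sylvester_sum_middle:
  assumes "k - K \<le> r" "r \<le> K"
  shows "12 * k ^ 2 * sylvester_sum gens =
      (2 * a ^ 4 + 6 * (3 * K - k) * a ^ 3
        + (30 * K ^ 2 + 12 * K * k - 19 * k ^ 2 + 24 * k - 6 * (r + 4 * K - 5 * k) * r) * a ^ 2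
        + (K ^ 2 * (14 * K + 18 * k) - 8 * K * k * (4 * k - 3)
           + 4 * r ^ 3 + 6 * (K - 4 * k) * r ^ 2
           - (24 * K ^ 2 - 6 * K * k - 32 * k ^ 2 + 24 * k) * r) * a
        - k ^ 2)
      + (4 * a ^ 3 + 3 * (12 * K - 4 * k + 1) * a ^ 2
           + (6 * K * (10 * K + 2 * k + 7) - (25 * k ^ 2 - 18 * k - 12)
              - 6 * r * (r + 4 * K - 5 * k)) * a
           + 28 * K ^ 3 - K ^ 2 * (9 * k - 39) - K * (19 * k ^ 2 + 15 * k - 12)
           + 2 * r ^ 3 - 3 * r ^ 2 * (2 * K + 3 * k + 1)
           + r * (- K * (24 * K - 18 * k + 36) + (19 * k ^ 2 + 15 * k - 12))) * k * d
      + (2 * a ^ 2 + 3 * (6 * K - 2 * k + 1) * a + 6 * K * (5 * K + 7) - 6 * k ^ 2 - 6 * k + 13) * k ^ 2 * d ^ 2"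
proof -
  have m: "max 0 (K - r) = K - r" "max k (min (2 * K + 1) (k + K - r)) = k + K - r"
    using assms K_lower K_less r_bounds by auto
  show ?thesis
  proof (rule sylvester_sum_expand[where p = "q - 1" and u = "k + r - K - 1", OF _ _ _ _ refl refl refl refl])
    show "a - 1 = (q - 1) * k + (k + r - K - 1)" by (simp add: a_eq algebra_simps)
    show "0 \<le> q - 1" "0 \<le> k + r - K - 1" "k + r - K - 1 \<le> k"
      using assms q_ge K_pos K_lower K_less r_bounds by simp_all
  qed (unfold m a_eq, algebra+)
qed

text \<open>Neither shifted gap is cut: \<open>parts (s + a)\<close> is \<open>q + 1\<close> on the
  first and \<open>q + 2\<close> on the second. Now \<open>r - K - 1 \<ge> 0\<close>, so
  \<open>a - 1\<close> contains \<open>q\<close> full blocks.\<close>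

lemma sylvester_sum_large:
  assumes "K + 1 \<le> r"
  shows "12 * k ^ 2 * sylvester_sum gens =
      (2 * a ^ 4 + 6 * (3 * K - k) * a ^ 3
        + (30 * K ^ 2 + 24 * K * k - 19 * k ^ 2 + 12 * k - 6 * (r + 4 * K - 3 * k) * r) * a ^ 2
        + (K ^ 2 * (14 * K + 30 * k) - 4 * K * k * (5 * k - 3)
           + 4 * r ^ 3 + 6 * (K - 2 * k) * r ^ 2
           - (24 * K ^ 2 + 18 * K * k - 20 * k ^ 2 + 12 * k) * r) * a
        - k ^ 2)
      + (4 * a ^ 3 + 3 * (12 * K - 4 * k + 1) * a ^ 2
           + (6 * K * (10 * K + 4 * k + 7) - (25 * k ^ 2 - 6 * k - 12)
              - 6 * r * (r + 4 * K - 3 * k)) * a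
           + 28 * K ^ 3 - 3 * K ^ 2 * (k - 13) - K * (7 * k ^ 2 + 9 * k - 12)
           + 2 * r ^ 3 - 3 * r ^ 2 * (2 * K + k + 1)
           + r * (- 6 * K * (4 * K - k + 6) + 7 * k ^ 2 + 9 * k - 12)) * k * d
      + (2 * a ^ 2 + 3 * (6 * K - 2 * k + 1) * a + 6 * K * (5 * K + 7) - 6 * k ^ 2 - 6 * k + 13) * k ^ 2 * d ^ 2"
proof -
  have m: "max 0 (K - r) = 0" "max k (min (2 * K + 1) (k + K - r)) = k"
    using assms K_lower K_less r_bounds by auto
  show ?thesis
  proof (rule sylvester_sum_expand[where p = "q" and u = "r - K - 1", OF _ _ _ _ refl refl refl refl])
    show "a - 1 = (q) * k + (r - K - 1)" by (simp add: a_eq algebra_simps)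
    show "0 \<le> q" "0 \<le> r - K - 1" "r - K - 1 \<le> k"
      using assms q_ge K_pos K_lower K_less r_bounds by simp_all
  qed (unfold m a_eq, algebra+)
qed

end

section \<open>From floors and real bounds to the integer setting\<close>

theorem theorem4:
  fixes a d K k r S :: int
  assumes "a > 0" and "d > 0" and "a \<ge> 2" and "gcd a d = 1"
    and "K > 0" and "k > 0"
    and "(real_of_int k - 1) / 2 < real_of_int K"
    and "real_of_int K \<le> (2 * real_of_int k - 2) / 3"
    and "r = a + K - \<lfloor>real_of_int (a + K) / real_of_int k\<rfloor> * k"
    and "\<lfloor>real_of_int (a + K) / real_of_int k\<rfloor> \<ge> 2"
    and "S = sylvester_sum (a # map (\<lambda>j. a + j * d) [K + 1..k])"
  shows
   "(0 \<le> r \<and> r \<le> k - K - 1 \<longrightarrow>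
      real_of_int S = 1 / (12 * real_of_int k ^ 2) * real_of_int
       (2 * a ^ 4 + 6 * (3 * K - k) * a ^ 3
        + (30 * K ^ 2 - 7 * k ^ 2 + 12 * k - 6 * (r + 4 * K - 3 * k) * r) * a ^ 2
        + (K ^ 2 * (14 * K + 6 * k) - 4 * K * k * (8 * k - 3) + 12 * k ^ 2 * (k - 1)
           + 4 * r ^ 3 + 6 * (K - 2 * k) * r ^ 2
           - (24 * K ^ 2 - 6 * K * k - 8 * k ^ 2 + 12 * k) * r) * a
        - k ^ 2
        + (2 * a ^ 2 + 3 * (6 * K - 2 * k + 1) * a + 6 * K * (5 * K + 7)
           - (6 * k ^ 2 + 6 * k - 13)) * k ^ 2 * d ^ 2
        + (4 * a ^ 3 + 3 * (12 * K - 4 * k + 1) * a ^ 2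
           + (6 * K * (10 * K + 7) - (13 * k ^ 2 - 6 * k - 12)
              - 6 * r * (r + 4 * K - 3 * k)) * a
           + 28 * K ^ 3 - K ^ 2 * (27 * k - 39) - K * (7 * k ^ 2 + 45 * k - 12)
           + 6 * (k - 1) * k * (k + 2)
           + 2 * r ^ 3 - 3 * r ^ 2 * (2 * K + k + 1)
           + r * (- 6 * K * (4 * K - k + 6) + 7 * k ^ 2 + 9 * k - 12)) * k * d))
    \<and>
    (k - K \<le> r \<and> r \<le> K \<longrightarrow>
      real_of_int S = 1 / (12 * real_of_int k ^ 2) * real_of_int
       (2 * a ^ 4 + 6 * (3 * K - k) * a ^ 3
        + (30 * K ^ 2 + 12 * K * k - 19 * k ^ 2 + 24 * k - 6 * (r + 4 * K - 5 * k) * r) * a ^ 2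
        + (K ^ 2 * (14 * K + 18 * k) - 8 * K * k * (4 * k - 3)
           + 4 * r ^ 3 + 6 * (K - 4 * k) * r ^ 2
           - (24 * K ^ 2 - 6 * K * k - 32 * k ^ 2 + 24 * k) * r) * a
        - k ^ 2
        + (2 * a ^ 2 + 3 * (6 * K - 2 * k + 1) * a + 6 * K * (5 * K + 7)
           - 6 * k ^ 2 - 6 * k + 13) * k ^ 2 * d ^ 2
        + (4 * a ^ 3 + 3 * (12 * K - 4 * k + 1) * a ^ 2
           + (6 * K * (10 * K + 2 * k + 7) - (25 * k ^ 2 - 18 * k - 12)
              - 6 * r * (r + 4 * K - 5 * k)) * a
           + 28 * K ^ 3 - K ^ 2 * (9 * k - 39) - K * (19 * k ^ 2 + 15 * k - 12)
           + 2 * r ^ 3 - 3 * r ^ 2 * (2 * K + 3 * k + 1)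
           + r * (- K * (24 * K - 18 * k + 36) + (19 * k ^ 2 + 15 * k - 12))) * k * d))
    \<and>
    (K + 1 \<le> r \<and> r < k \<longrightarrow>
      real_of_int S = 1 / (12 * real_of_int k ^ 2) * real_of_int
       (2 * a ^ 4 + 6 * (3 * K - k) * a ^ 3
        + (30 * K ^ 2 + 24 * K * k - 19 * k ^ 2 + 12 * k - 6 * (r + 4 * K - 3 * k) * r) * a ^ 2
        + (K ^ 2 * (14 * K + 30 * k) - 4 * K * k * (5 * k - 3)
           + 4 * r ^ 3 + 6 * (K - 2 * k) * r ^ 2
           - (24 * K ^ 2 + 18 * K * k - 20 * k ^ 2 + 12 * k) * r) * a
        - k ^ 2
        + (2 * a ^ 2 + 3 * (6 * K - 2 * k + 1) * a + 6 * K * (5 * K + 7)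
           - 6 * k ^ 2 - 6 * k + 13) * k ^ 2 * d ^ 2
        + (4 * a ^ 3 + 3 * (12 * K - 4 * k + 1) * a ^ 2
           + (6 * K * (10 * K + 4 * k + 7) - (25 * k ^ 2 - 6 * k - 12)
              - 6 * r * (r + 4 * K - 3 * k)) * a
           + 28 * K ^ 3 - 3 * K ^ 2 * (k - 13) - K * (7 * k ^ 2 + 9 * k - 12)
           + 2 * r ^ 3 - 3 * r ^ 2 * (2 * K + k + 1)
           + r * (- 6 * K * (4 * K - k + 6) + 7 * k ^ 2 + 9 * k - 12)) * k * d))"
proof -
  \<comment> \<open>The floor of the real quotient is integer division, so \<open>r\<close> is a
    remainder modulo \<open>k\<close> and its bounds follow.\<close>
  define q where "q = \<lfloor>real_of_int (a + K) / real_of_int k\<rfloor>"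
  have q: "q = (a + K) div k" unfolding q_def by (rule floor_divide_of_int_eq)
  then have r: "r = (a + K) mod k"
    using assms(9) unfolding q_def[symmetric] by (simp add: minus_div_mult_eq_mod)
  interpret progression_generators a d K k q r
  proof
    show "coprime a d" using assms(4) by (simp add: coprime_iff_gcd_eq_1)
    have "real_of_int k < real_of_int (2 * K + 1)" "real_of_int (3 * K) \<le> real_of_int (2 * k - 2)"
      using assms(7,8) by simp_all
    then show "k \<le> 2 * K" "3 * K \<le> 2 * k - 2"
      unfolding of_int_less_iff of_int_le_iff by simp_all
    show "a = q * k + r - K" using assms(9) unfolding q_def[symmetric] by simp
    show "2 \<le> q" using assms(10) unfolding q_def[symmetric] .
  qed (use assms(2,5,6) in \<open>simp_all add: r\<close>)
  have S: "S = sylvester_sum gens" using assms(11) by (simp add: gens_def)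
  have real_eq: "real_of_int S = 1 / (12 * real_of_int k ^ 2) * real_of_int P"
    if "12 * k ^ 2 * sylvester_sum gens = P" for P
    using that assms(6) by (auto simp: S)
  show ?thesis
    by (intro conjI impI; (elim conjE)?; rule real_eq)
      (use sylvester_sum_small sylvester_sum_middle sylvester_sum_large in \<open>simp_all add: ac_simps\<close>)
qed

end
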